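(* Let $\Gamma$ be a finite quiver. The following relations hold in $\mathrm{Der}(\mathbf{k}\Gamma)$: $$[D_p,D_r]=D_{[p,r]}\quad\text{for } p,r\in\mathcal{P};$$ $$[D_p,D_{r,s}]=-D_{D_{r,s}(p)}\quad\text{for } r\in E,\ p,s\in\mathcal{P},\ s\parallel r;$$ $$[D_{r,s},D_{p,q}]=D_{p,D_{r,s}(q)}-D_{r,D_{p,q}(s)}\quad\text{for } r,p\in E,\ s,q\in\mathcal{P},\ s\parallel r,\ q\parallel p.$$
   Context: $\mathbf{k}$ is a field. A quiver $\Gamma=(V,E,t,h)$ consists of a set $V$ of vertices, a set $E$ of arrows and maps $t,h:E\to V$ (tail and head); it is finite if $V$ and $E$ are finite. A path of length $\ell\ge0$ is $p=v_0p_1v_1\cdots p_\ell v_\ell$ with $p_j\in E$, $t(p_j)=v_{j-1}$, $h(p_j)=v_j$; $t(p)=v_0$, $h(p)=v_\ell$; vertices are the paths of length $0$. $\mathcal{P}$ is the set of all paths. The path algebra $\mathbf{k}\Gamma$ has basis $\mathcal{P}$, with product of $p,q\in\mathcal{P}$ the concatenation $pq$ if $h(p)=t(q)$ and $0$ otherwise. $p\parallel q$ means $t(p)=t(q)$ and $h(p)=h(q)$. $\mathrm{Der}(A)$ is the Lie algebra of derivations of $A$ under the commutator. For $a\in\mathbf{k}\Gamma$, $D_a$ is the inner derivation $D_a(b)=ab-ba$; $[p,r]=pr-rp$ in $\mathbf{k}\Gamma$. For $r\in E$ and $s\in\mathcal{P}$, $s\parallel r$, $D_{r,s}:\mathbf{k}\Gamma\to\mathbf{k}\Gamma$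 is the linear operator (a derivation) defined on paths by $D_{r,s}(v)=0$ for $v\in V$ and recursively, for $p=p_1\tilde p$ with $p_1\in E$ and $\tilde p\in\mathcal{P}$, $D_{r,s}(p)=s\tilde p+p_1D_{r,s}(\tilde p)$ if $p_1=r$ and $D_{r,s}(p)=p_1D_{r,s}(\tilde p)$ if $p_1\ne r$. For $p\in E$ and $x=\sum_{i=1}^k c_iq_i\in\mathbf{k}\Gamma$ with $c_i\in\mathbf{k}$, $q_i\in\mathcal{P}$, put $D_{p,x}:=\sum_{i:\ q_i\parallel p}c_iD_{p,q_i}$. *)

theory Defs
  imports
    "HOL-Library.FuncSet"
    "HOL-Library.Poly_Mapping"
    "Graph_Theory.Arc_Walk"
begin

text \<open>
  A quiver is a \<^locale>\<open>wf_digraph\<close>: loops and parallel arrows are allowed, and the tail and head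
  maps send arrows to vertices.  A finite quiver is a \<^locale>\<open>fin_digraph\<close>.

  A path is encoded as its starting vertex together with its list of arrows.  Vertices are the
  paths with an empty list; for a nonempty list the starting vertex is determined by the first arrow.
\<close>

type_synonym ('v, 'e) qpath = "'v \<times> 'e list"

definition paths :: "('v, 'e) pre_digraph \<Rightarrow> ('v, 'e) qpath set" where
  "paths G = {(v, es). \<exists>w. pre_digraph.awalk G v es w}"

definition ptail :: "('v, 'e) qpath \<Rightarrow> 'v" where
  "ptail p = fst p"

definition phead :: "('v, 'e) pre_digraph \<Rightarrow> ('v, 'e) qpath \<Rightarrow> 'v" where
  "phead G p = pre_digraph.awlast G (fst p) (snd p)"

definition parallel :: "('v, 'e) pre_digraph \<Rightarrow> ('v, 'e) qpath \<Rightarrow> ('v, 'e) qpath \<Rightarrow> bool" where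
  "parallel G p q \<longleftrightarrow> ptail p = ptail q \<and> phead G p = phead G q"

definition arrow_path :: "('v, 'e) pre_digraph \<Rightarrow> 'e \<Rightarrow> ('v, 'e) qpath" where
  "arrow_path G e = (tail G e, [e])"

definition pconcat :: "('v, 'e) qpath \<Rightarrow> ('v, 'e) qpath \<Rightarrow> ('v, 'e) qpath" where
  "pconcat p q = (fst p, snd p @ snd q)"

text \<open>
  Elements of the path algebra are the finitely supported functions on encoded paths whose support
  consists of genuine paths; addition is that of \<^typ>\<open>'a \<Rightarrow>\<^sub>0 'b\<close>.
\<close>

type_synonym ('v, 'e, 'k) pelt = "('v, 'e) qpath \<Rightarrow>\<^sub>0 'k"

definition path_algebra :: "('v, 'e) pre_digraph \<Rightarrow> ('v, 'e, 'k::field) pelt set" where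
  "path_algebra G = {x. Poly_Mapping.keys x \<subseteq> paths G}"

definition pbasis :: "('v, 'e) qpath \<Rightarrow> ('v, 'e, 'k::field) pelt" where
  "pbasis p = Poly_Mapping.single p 1"

definition pscale :: "'k::field \<Rightarrow> ('v, 'e, 'k) pelt \<Rightarrow> ('v, 'e, 'k) pelt" where
  "pscale c x = Poly_Mapping.map (\<lambda>y. c * y) x"

definition pmult ::
  "('v, 'e) pre_digraph \<Rightarrow> ('v, 'e, 'k::field) pelt \<Rightarrow> ('v, 'e, 'k) pelt \<Rightarrow> ('v, 'e, 'k) pelt" where
  "pmult G x y =
     (\<Sum>p\<in>Poly_Mapping.keys x. \<Sum>q\<in>Poly_Mapping.keys y.
        if phead G p = ptail q
        then pscale (Poly_Mapping.lookup x p * Poly_Mapping.lookup y q) (pbasis (pconcat p q))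
        else 0)"

definition pcomm ::
  "('v, 'e) pre_digraph \<Rightarrow> ('v, 'e, 'k::field) pelt \<Rightarrow> ('v, 'e, 'k) pelt \<Rightarrow> ('v, 'e, 'k) pelt" where
  "pcomm G x y = pmult G x y - pmult G y x"

text \<open>
  Operators on the path algebra are restricted to its carrier (and are \<^const>\<open>undefined\<close> outside),
  so that equality in the Lie algebra of derivations is equality of HOL functions.
\<close>

definition Der ::
  "('v, 'e) pre_digraph \<Rightarrow> (('v, 'e, 'k::field) pelt \<Rightarrow> ('v, 'e, 'k) pelt) set" where
  "Der G = {d \<in> path_algebra G \<rightarrow>\<^sub>E path_algebra G.
     (\<forall>x\<in>path_algebra G. \<forall>y\<in>path_algebra G. d (x + y) = d x + d y) \<and>
     (\<forall>c. \<forall>x\<in>path_algebra G. d (pscale c x) = pscale c (d x)) \<and>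
     (\<forall>x\<in>path_algebra G. \<forall>y\<in>path_algebra G.
        d (pmult G x y) = pmult G (d x) y + pmult G x (d y))}"

definition der_minus ::
  "('v, 'e) pre_digraph \<Rightarrow> (('v, 'e, 'k::field) pelt \<Rightarrow> ('v, 'e, 'k) pelt)
     \<Rightarrow> (('v, 'e, 'k) pelt \<Rightarrow> ('v, 'e, 'k) pelt) \<Rightarrow> ('v, 'e, 'k) pelt \<Rightarrow> ('v, 'e, 'k) pelt" where
  "der_minus G d d' = (\<lambda>x\<in>path_algebra G. d x - d' x)"

definition der_uminus ::
  "('v, 'e) pre_digraph \<Rightarrow> (('v, 'e, 'k::field) pelt \<Rightarrow> ('v, 'e, 'k) pelt)
     \<Rightarrow> ('v, 'e, 'k) pelt \<Rightarrow> ('v, 'e, 'k) pelt" where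
  "der_uminus G d = (\<lambda>x\<in>path_algebra G. - d x)"

definition der_bracket ::
  "('v, 'e) pre_digraph \<Rightarrow> (('v, 'e, 'k::field) pelt \<Rightarrow> ('v, 'e, 'k) pelt)
     \<Rightarrow> (('v, 'e, 'k) pelt \<Rightarrow> ('v, 'e, 'k) pelt) \<Rightarrow> ('v, 'e, 'k) pelt \<Rightarrow> ('v, 'e, 'k) pelt" where
  "der_bracket G d d' = (\<lambda>x\<in>path_algebra G. d (d' x) - d' (d x))"

definition inner_der ::
  "('v, 'e) pre_digraph \<Rightarrow> ('v, 'e, 'k::field) pelt \<Rightarrow> ('v, 'e, 'k) pelt \<Rightarrow> ('v, 'e, 'k) pelt" where
  "inner_der G a = (\<lambda>b\<in>path_algebra G. pmult G a b - pmult G b a)"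

text \<open>
  The value of \<open>D\<^bsub>r,s\<^esub>\<close> on a path depends only on its list of arrows: in the recursion the tail
  of \<open>e # es\<close> is the path with arrow list \<open>es\<close> starting at the head of \<open>e\<close>.
\<close>

primrec arrow_der_path ::
  "('v, 'e) pre_digraph \<Rightarrow> 'e \<Rightarrow> ('v, 'e) qpath \<Rightarrow> 'e list \<Rightarrow> ('v, 'e, 'k::field) pelt" where
  "arrow_der_path G r s [] = 0"
| "arrow_der_path G r s (e # es) =
     (if e = r
      then pmult G (pbasis s) (pbasis (head G e, es))
           + pmult G (pbasis (arrow_path G e)) (arrow_der_path G r s es)
      else pmult G (pbasis (arrow_path G e)) (arrow_der_path G r s es))"

definition arrow_der ::
  "('v, 'e) pre_digraph \<Rightarrow> 'e \<Rightarrow> ('v, 'e) qpath \<Rightarrow> ('v, 'e, 'k::field) pelt \<Rightarrow> ('v, 'e, 'k) pelt" where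
  "arrow_der G r s = (\<lambda>x\<in>path_algebra G.
     \<Sum>p\<in>Poly_Mapping.keys x. pscale (Poly_Mapping.lookup x p) (arrow_der_path G r s (snd p)))"

definition arrow_der_ext ::
  "('v, 'e) pre_digraph \<Rightarrow> 'e \<Rightarrow> ('v, 'e, 'k::field) pelt \<Rightarrow> ('v, 'e, 'k) pelt \<Rightarrow> ('v, 'e, 'k) pelt"
  where
  "arrow_der_ext G p x = (\<lambda>b\<in>path_algebra G.
     \<Sum>q\<in>{q \<in> Poly_Mapping.keys x. parallel G q (arrow_path G p)}.
       pscale (Poly_Mapping.lookup x q) (arrow_der G p q b))"

end

theory Submission
  imports Defs
begin

text \<open>
  A derivation of the path algebra is determined by its values on vertices and arrows.  For the
  third relation both sides are derivations that vanish on vertices, and on an arrow they agree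
  because \<open>D\<^bsub>r,s\<^esub>\<close> maps a path to a combination of paths parallel to it.  The same fact yields the
  Leibniz rule on pairs of paths that cannot be concatenated.  The first relation is the case
  \<open>d = D\<^bsub>r\<^esub>\<close> of \<open>[D\<^bsub>a\<^esub>, d] = -D\<^bsub>d(a)\<^esub>\<close>, which holds for every derivation \<open>d\<close>.
\<close>

section \<open>Linear extension\<close>

lemma lookup_pscale [simp]: "Poly_Mapping.lookup (pscale c x) p = c * Poly_Mapping.lookup x p"
  by (simp add: pscale_def Poly_Mapping.map.rep_eq when_def)

lemma pscale_zero [simp]: "pscale c 0 = 0" "pscale 0 x = 0"
  by (auto intro!: poly_mapping_eqI)

lemma pscale_one [simp]: "pscale 1 x = x"
  by (auto intro!: poly_mapping_eqI)

lemma pscale_pscale [simp]: "pscale c (pscale d x) = pscale (c * d) x"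
  by (auto intro!: poly_mapping_eqI)

lemma pscale_add_right: "pscale c (x + y) = pscale c x + pscale c y"
  by (auto intro!: poly_mapping_eqI simp: lookup_add algebra_simps)

lemma pscale_add_left: "pscale (c + d) x = pscale c x + pscale d x"
  by (auto intro!: poly_mapping_eqI simp: lookup_add algebra_simps)

lemma pscale_diff_right: "pscale c (x - y) = pscale c x - pscale c y"
  by (auto intro!: poly_mapping_eqI simp: lookup_minus right_diff_distrib)

lemma pscale_sum_right: "pscale c (\<Sum>i\<in>I. f i) = (\<Sum>i\<in>I. pscale c (f i))"
  by (induction I rule: infinite_finite_induct) (auto simp: pscale_add_right)

lemma keys_pscale_subset: "Poly_Mapping.keys (pscale c x) \<subseteq> Poly_Mapping.keys x"
  by (auto simp: in_keys_iff)

lemma keys_pbasis [simp]: "Poly_Mapping.keys (pbasis p :: ('v, 'e, 'k::field) pelt) = {p}"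
  by (simp add: pbasis_def)

lemma lookup_pbasis_self [simp]: "Poly_Mapping.lookup (pbasis p) p = 1"
  by (simp add: pbasis_def)

lemma pelt_expansion:
  "(\<Sum>p\<in>Poly_Mapping.keys x. pscale (Poly_Mapping.lookup x p) (pbasis p)) = x"
proof (rule poly_mapping_eqI)
  fix k
  have "Poly_Mapping.lookup (\<Sum>p\<in>Poly_Mapping.keys x. pscale (Poly_Mapping.lookup x p) (pbasis p)) k
      = (\<Sum>p\<in>Poly_Mapping.keys x. if k = p then Poly_Mapping.lookup x p else 0)"
    unfolding lookup_sum by (intro sum.cong) (auto simp: pbasis_def lookup_single when_def)
  also have "\<dots> = Poly_Mapping.lookup x k"
    by (simp add: in_keys_iff)
  finally show "Poly_Mapping.lookup (\<Sum>p\<in>Poly_Mapping.keys x.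
      pscale (Poly_Mapping.lookup x p) (pbasis p)) k = Poly_Mapping.lookup x k" .
qed

text \<open>Multiplication, in each argument, and the arrow derivations are linear extensions of
  maps on paths; their linearity is thus proved once, here.\<close>

definition lin_ext ::
  "(('v, 'e) qpath \<Rightarrow> ('v, 'e, 'k::field) pelt) \<Rightarrow> ('v, 'e, 'k) pelt \<Rightarrow> ('v, 'e, 'k) pelt" where
  "lin_ext f x = (\<Sum>p\<in>Poly_Mapping.keys x. pscale (Poly_Mapping.lookup x p) (f p))"

lemma lin_ext_superset:
  assumes "finite A" "Poly_Mapping.keys x \<subseteq> A"
  shows "lin_ext f x = (\<Sum>p\<in>A. pscale (Poly_Mapping.lookup x p) (f p))"
  unfolding lin_ext_def using assms by (intro sum.mono_neutral_left) (auto simp: in_keys_iff)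

lemma lin_ext_add: "lin_ext f (x + y) = lin_ext f x + lin_ext f y"
proof -
  \<comment> \<open>Cancellation can make the support of \<open>x + y\<close> smaller than the
    union, so all three sums are taken over the union, where extra terms have coefficient 0.\<close>
  let ?A = "Poly_Mapping.keys x \<union> Poly_Mapping.keys y"
  have "Poly_Mapping.keys (x + y) \<subseteq> ?A"
    by (rule Poly_Mapping.keys_add)
  then show ?thesis
    by (simp add: lin_ext_superset[of ?A] lookup_add pscale_add_left sum.distrib)
qed

lemma lin_ext_pscale: "lin_ext f (pscale c x) = pscale c (lin_ext f x)"
  \<comment> \<open>For \<open>c = 0\<close> the support collapses, so the sum is first extended to
    the support of \<open>x\<close>.\<close>
  by (subst lin_ext_superset[OF finite_keys keys_pscale_subset])
    (simp add: lin_ext_def pscale_sum_right)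

lemma lin_ext_pbasis [simp]: "lin_ext f (pbasis p) = f p"
  by (simp add: lin_ext_def)

lemma lin_ext_add_fun: "lin_ext (\<lambda>p. f p + g p) x = lin_ext f x + lin_ext g x"
  by (simp add: lin_ext_def pscale_add_right sum.distrib)

lemma lin_ext_pscale_fun: "lin_ext (\<lambda>p. pscale c (f p)) x = pscale c (lin_ext f x)"
  by (simp add: lin_ext_def pscale_sum_right mult.commute)

section \<open>The path algebra as a subspace, and induction over its elements\<close>

lemma path_algebra_zero [simp]: "0 \<in> path_algebra G"
  by (simp add: path_algebra_def)

lemma path_algebra_add: "x \<in> path_algebra G \<Longrightarrow> y \<in> path_algebra G \<Longrightarrow> x + y \<in> path_algebra G"
  using Poly_Mapping.keys_add[of x y] by (auto simp: path_algebra_def)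

lemma path_algebra_pscale: "x \<in> path_algebra G \<Longrightarrow> pscale c x \<in> path_algebra G"
  using keys_pscale_subset[of c x] by (auto simp: path_algebra_def)

lemma path_algebra_uminus: "x \<in> path_algebra G \<Longrightarrow> - x \<in> path_algebra G"
  by (simp add: path_algebra_def keys_def)

lemma path_algebra_diff: "x \<in> path_algebra G \<Longrightarrow> y \<in> path_algebra G \<Longrightarrow> x - y \<in> path_algebra G"
  using path_algebra_add[OF _ path_algebra_uminus, of x G y] by simp

lemma path_algebra_sum:
  "(\<And>i. i \<in> I \<Longrightarrow> f i \<in> path_algebra G) \<Longrightarrow> (\<Sum>i\<in>I. f i) \<in> path_algebra G"
  by (induction I rule: infinite_finite_induct) (auto intro: path_algebra_add)

lemma pbasis_in_path_algebra [simp]: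
  "(pbasis p :: ('v, 'e, 'k::field) pelt) \<in> path_algebra G \<longleftrightarrow> p \<in> paths G"
  by (simp add: path_algebra_def)

text \<open>Reduces a property preserved by sums to scalar multiples of single paths; it is how
  identities pass from paths to the whole algebra.\<close>

lemma path_algebra_induct [consumes 1, case_names zero basis add]:
  fixes x :: "('v, 'e, 'k::field) pelt"
  assumes "x \<in> path_algebra G"
    and zero: "P 0"
    and basis: "\<And>c p. p \<in> paths G \<Longrightarrow> P (pscale c (pbasis p))"
    and add: "\<And>x y. x \<in> path_algebra G \<Longrightarrow> y \<in> path_algebra G \<Longrightarrow> P x \<Longrightarrow> P y \<Longrightarrow> P (x + y)"
  shows "P x"
proof -
  \<comment> \<open>The coefficients stay those of the fixed \<open>x\<close> while \<open>K\<close>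
    grows; at \<open>K\<close> equal to the support, the partial sum is \<open>x\<close>.\<close>
  have "finite K \<Longrightarrow> K \<subseteq> paths G \<Longrightarrow> P (\<Sum>p\<in>K. pscale (Poly_Mapping.lookup x p) (pbasis p))" for K
  proof (induction K rule: finite_induct)
    case (insert p K)
    then show ?case
      by (auto intro!: add basis path_algebra_sum path_algebra_pscale)
  qed (simp add: zero)
  from this[of "Poly_Mapping.keys x"] assms(1) show ?thesis
    by (simp add: pelt_expansion path_algebra_def)
qed

section \<open>Multiplication\<close>

definition path_mult ::
  "('v, 'e) pre_digraph \<Rightarrow> ('v, 'e) qpath \<Rightarrow> ('v, 'e) qpath \<Rightarrow> ('v, 'e, 'k::field) pelt" where
  "path_mult G p q = (if phead G p = ptail q then pbasis (pconcat p q) else 0)"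

text \<open>Exhibits the product as the bilinear extension of \<open>path_mult\<close>, from which
  all its linearity laws follow.\<close>

lemma pmult_eq_lin_ext: "pmult G x y = lin_ext (\<lambda>p. lin_ext (path_mult G p) y) x"
  by (auto simp: pmult_def lin_ext_def path_mult_def pscale_sum_right intro!: sum.cong)

lemma pmult_add_left: "pmult G (x + y) z = pmult G x z + pmult G y z"
  by (simp add: pmult_eq_lin_ext lin_ext_add)

lemma pmult_add_right: "pmult G x (y + z) = pmult G x y + pmult G x z"
  by (simp add: pmult_eq_lin_ext lin_ext_add lin_ext_add_fun)

lemma pmult_pscale_left: "pmult G (pscale c x) y = pscale c (pmult G x y)"
  by (simp add: pmult_eq_lin_ext lin_ext_pscale)

lemma pmult_pscale_right: "pmult G x (pscale c y) = pscale c (pmult G x y)"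
  by (simp add: pmult_eq_lin_ext lin_ext_pscale lin_ext_pscale_fun)

lemma pmult_zero [simp]: "pmult G 0 y = 0" "pmult G x 0 = 0"
  by (simp_all add: pmult_def)

lemma pmult_diff_left: "pmult G (x - y) z = pmult G x z - pmult G y z"
  using pmult_add_left[of G "x - y" y z] by (simp add: algebra_simps)

lemma pmult_diff_right: "pmult G x (y - z) = pmult G x y - pmult G x z"
  using pmult_add_right[of G x "y - z" z] by (simp add: algebra_simps)

lemma pmult_sum_left: "pmult G (\<Sum>i\<in>I. f i) y = (\<Sum>i\<in>I. pmult G (f i) y)"
  by (induction I rule: infinite_finite_induct) (auto simp: pmult_add_left)

lemma pmult_sum_right: "pmult G x (\<Sum>i\<in>I. f i) = (\<Sum>i\<in>I. pmult G x (f i))"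
  by (induction I rule: infinite_finite_induct) (auto simp: pmult_add_right)

lemma pmult_pbasis: "pmult G (pbasis p) (pbasis q) = path_mult G p q"
  by (simp add: pmult_eq_lin_ext)

section \<open>Heads and tails of concatenations, and associativity\<close>

lemma phead_Nil [simp]: "phead G (v, []) = v"
  by (simp add: phead_def pre_digraph.awalk_verts.simps)

text \<open>Once an arrow is present, the last vertex is read off the arrows, so \<open>v\<close>
  has no influence on it.\<close>

lemma awlast_Cons: "pre_digraph.awlast G v (e # es) = pre_digraph.awlast G (head G e) es"
  by (cases es) (simp_all add: pre_digraph.awalk_verts.simps)

lemma awlast_append:
  "pre_digraph.awlast G v (es @ fs) = pre_digraph.awlast G (pre_digraph.awlast G v es) fs"
proof (induction es arbitrary: v)
  case Nil
  then show ?case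
    by (simp add: pre_digraph.awalk_verts.simps)
next
  case (Cons e es)
  then show ?case
    by (simp only: append_Cons awlast_Cons)
qed

lemma phead_Cons: "phead G (v, e # es) = phead G (head G e, es)"
  by (simp only: phead_def fst_conv snd_conv awlast_Cons)

lemma phead_pconcat [simp]: "phead G p = ptail q \<Longrightarrow> phead G (pconcat p q) = phead G q"
  by (simp only: phead_def ptail_def pconcat_def awlast_append fst_conv snd_conv)

lemma ptail_simps [simp]: "ptail (v, es) = v" "ptail (pconcat p q) = ptail p"
  by (simp_all add: ptail_def pconcat_def)

lemma arrow_path_simps [simp]:
  "ptail (arrow_path G e) = tail G e" "phead G (arrow_path G e) = head G e"
  by (simp_all add: arrow_path_def phead_Cons)

lemma pconcat_assoc: "pconcat (pconcat p q) r = pconcat p (pconcat q r)"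
  by (simp add: pconcat_def)

text \<open>Peeling off the first arrow drives the inductions along a path below.\<close>

lemma pbasis_Cons:
  "pbasis (tail G e, e # es) = pmult G (pbasis (arrow_path G e)) (pbasis (head G e, es))"
  \<comment> \<open>The composability test is decided through \<open>arrow_path_simps\<close> first;
    only then are \<open>arrow_path\<close> and \<open>pconcat\<close> unfolded.\<close>
  by (simp add: pmult_pbasis path_mult_def) (simp add: pconcat_def arrow_path_def)

text \<open>If both junctions match, each side is the triple concatenation; if one fails, both sides
  are 0, since concatenation keeps the outer tail and head.\<close>

lemma pmult_assoc_pbasis:
  "pmult G (pmult G (pbasis p) (pbasis q)) (pbasis r)
     = pmult G (pbasis p) (pmult G (pbasis q) (pbasis r))"
  by (auto simp: pmult_pbasis path_mult_def pconcat_assoc)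

lemma pmult_assoc:
  "pmult G (pmult G x y) z = pmult G x (pmult G y z)"
proof -
  \<comment> \<open>Naming the expansion lets each factor be replaced by its basis expansion without
    rewriting \<open>x\<close> into itself repeatedly.\<close>
  define e where "e w = (\<Sum>p\<in>Poly_Mapping.keys w. pscale (Poly_Mapping.lookup w p) (pbasis p))"
    for w :: "('a, 'b, 'c) pelt"
  have "pmult G (pmult G (e x) (e y)) (e z) = pmult G (e x) (pmult G (e y) (e z))"
    unfolding e_def
    by (simp add: pmult_sum_left pmult_sum_right pmult_pscale_left pmult_pscale_right
        pmult_assoc_pbasis)
  then show ?thesis
    by (simp add: e_def pelt_expansion)
qed

text \<open>A nonzero coefficient at \<open>k\<close> forces some summand of the double sum to be
  nonzero at \<open>k\<close>, and each summand is supported on one concatenation.\<close>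

lemma keys_pmult_subset:
  "Poly_Mapping.keys (pmult G x y)
     \<subseteq> {pconcat p q |p q. p \<in> Poly_Mapping.keys x \<and> q \<in> Poly_Mapping.keys y \<and> phead G p = ptail q}"
proof
  fix k assume "k \<in> Poly_Mapping.keys (pmult G x y)"
  then have "Poly_Mapping.lookup (pmult G x y) k \<noteq> 0"
    by (simp add: in_keys_iff)
  then obtain p q where pq: "p \<in> Poly_Mapping.keys x" "q \<in> Poly_Mapping.keys y"
    "Poly_Mapping.lookup (if phead G p = ptail q
        then pscale (Poly_Mapping.lookup x p * Poly_Mapping.lookup y q) (pbasis (pconcat p q))
        else 0) k \<noteq> 0"
    unfolding pmult_def lookup_sum by (metis (no_types, lifting) sum.neutral)
  then have "phead G p = ptail q" "k = pconcat p q"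
    by (auto simp: pbasis_def lookup_single when_def split: if_splits)
  with pq show "k \<in> {pconcat p q |p q. p \<in> Poly_Mapping.keys x \<and> q \<in> Poly_Mapping.keys y
      \<and> phead G p = ptail q}"
    by blast
qed

lemma pmult_eq_zeroI:
  assumes "\<And>p q. p \<in> Poly_Mapping.keys x \<Longrightarrow> q \<in> Poly_Mapping.keys y \<Longrightarrow> phead G p \<noteq> ptail q"
  shows "pmult G x y = 0"
  unfolding pmult_def using assms by (intro sum.neutral ballI) auto

lemma pmult_vertex_left:
  assumes "\<And>q. q \<in> Poly_Mapping.keys x \<Longrightarrow> ptail q = v"
  shows "pmult G (pbasis (v, [])) x = x"
proof -
  have "pmult G (pbasis (v, [])) x = lin_ext (path_mult G (v, [])) x"
    by (simp add: pmult_eq_lin_ext)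
  also have "\<dots> = (\<Sum>p\<in>Poly_Mapping.keys x. pscale (Poly_Mapping.lookup x p) (pbasis p))"
    unfolding lin_ext_def using assms
    by (intro sum.cong) (auto simp: path_mult_def pconcat_def ptail_def)
  finally show ?thesis
    by (simp add: pelt_expansion)
qed

section \<open>Closure of paths and of the path algebra under multiplication\<close>

context wf_digraph
begin

lemma vertex_in_paths [simp]: "(v, []) \<in> paths G \<longleftrightarrow> v \<in> verts G"
  by (auto simp: paths_def awalk_simps)

lemma Cons_in_paths [simp]:
  "(v, e # es) \<in> paths G \<longleftrightarrow> e \<in> arcs G \<and> v = tail G e \<and> (head G e, es) \<in> paths G"
  by (auto simp: paths_def awalk_simps)

lemma pconcat_in_paths:
  assumes "p \<in> paths G" "q \<in> paths G" "phead G p = ptail q"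
  shows "pconcat p q \<in> paths G"
proof -
  obtain u es w fs where pq: "p = (u, es)" "q = (w, fs)"
    by (cases p, cases q)
  \<comment> \<open>The start vertex is generalised because the induction step moves to the head of
    the first arrow.\<close>
  have "(u, es) \<in> paths G \<Longrightarrow> (w, fs) \<in> paths G \<Longrightarrow> phead G (u, es) = w
    \<Longrightarrow> (u, es @ fs) \<in> paths G"
    by (induction es arbitrary: u) (auto simp: phead_Cons)
  with assms show ?thesis
    by (simp add: pq pconcat_def)
qed

lemma path_algebra_pmult:
  assumes "x \<in> path_algebra G" "y \<in> path_algebra G"
  shows "pmult G x y \<in> path_algebra G"
  using keys_pmult_subset[of G x y] assms pconcat_in_paths
  unfolding path_algebra_def by blast

end

section \<open>Derivations\<close>

lemma DerI:
  assumes "\<And>x. x \<notin> path_algebra G \<Longrightarrow> d x = undefined"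
    and "\<And>x. x \<in> path_algebra G \<Longrightarrow> d x \<in> path_algebra G"
    and "\<And>x y. x \<in> path_algebra G \<Longrightarrow> y \<in> path_algebra G \<Longrightarrow> d (x + y) = d x + d y"
    and "\<And>c x. x \<in> path_algebra G \<Longrightarrow> d (pscale c x) = pscale c (d x)"
    and "\<And>x y. x \<in> path_algebra G \<Longrightarrow> y \<in> path_algebra G
      \<Longrightarrow> d (pmult G x y) = pmult G (d x) y + pmult G x (d y)"
  shows "d \<in> Der G"
  using assms by (auto simp: Der_def)

context
  fixes G :: "('v, 'e) pre_digraph" and d :: "('v, 'e, 'k::field) pelt \<Rightarrow> ('v, 'e, 'k) pelt"
  assumes d: "d \<in> Der G"
begin

lemma Der_outside: "x \<notin> path_algebra G \<Longrightarrow> d x = undefined"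
  using d by (auto simp: Der_def)

lemma Der_closed: "x \<in> path_algebra G \<Longrightarrow> d x \<in> path_algebra G"
  using d by (auto simp: Der_def)

lemma Der_add: "x \<in> path_algebra G \<Longrightarrow> y \<in> path_algebra G \<Longrightarrow> d (x + y) = d x + d y"
  using d by (auto simp: Der_def)

lemma Der_pscale: "x \<in> path_algebra G \<Longrightarrow> d (pscale c x) = pscale c (d x)"
  using d by (auto simp: Der_def)

lemma Der_pmult:
  "x \<in> path_algebra G \<Longrightarrow> y \<in> path_algebra G \<Longrightarrow> d (pmult G x y) = pmult G (d x) y + pmult G x (d y)"
  using d by (auto simp: Der_def)

lemma Der_zero: "d 0 = 0"
  \<comment> \<open>Additivity at 0 + 0 gives \<open>d 0 = d 0 + d 0\<close>.\<close>
  using Der_add[of 0 0] by simp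

lemma Der_diff:
  assumes "x \<in> path_algebra G" "y \<in> path_algebra G"
  shows "d (x - y) = d x - d y"
  using Der_add[of "x - y" y] assms by (simp add: path_algebra_diff algebra_simps)

end

section \<open>Lie operations on derivations and brackets with inner derivations\<close>

context wf_digraph
begin

text \<open>Vertices and arrows generate the algebra: the Leibniz rule carries agreement along a
  path arrow by arrow, and linearity carries it to all elements.\<close>

lemma Der_eqI:
  fixes d d' :: "('a, 'b, 'k::field) pelt \<Rightarrow> ('a, 'b, 'k) pelt"
  assumes d: "d \<in> Der G" and d': "d' \<in> Der G"
    and vertex: "\<And>v. v \<in> verts G \<Longrightarrow> d (pbasis (v, [])) = d' (pbasis (v, []))"
    and arrow: "\<And>e. e \<in> arcs G \<Longrightarrow> d (pbasis (arrow_path G e)) = d' (pbasis (arrow_path G e))"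
  shows "d = d'"
proof
  fix x
  have path: "(v, es) \<in> paths G \<Longrightarrow> d (pbasis (v, es)) = d' (pbasis (v, es))" for v es
  proof (induction es arbitrary: v)
    case (Cons e es)
    have "pbasis (v, e # es)
        = (pmult G (pbasis (arrow_path G e)) (pbasis (head G e, es)) :: ('a, 'b, 'k) pelt)"
      using Cons.prems by (simp add: pbasis_Cons)
    moreover have "arrow_path G e \<in> paths G"
      using Cons.prems by (auto simp: arrow_path_def)
    ultimately show ?case
      using Cons by (simp add: Der_pmult[OF d] Der_pmult[OF d'] arrow)
  qed (simp add: vertex)
  show "d x = d' x"
  proof (cases "x \<in> path_algebra G")
    case True
    then show ?thesis
    proof (induction x rule: path_algebra_induct)
      case (basis c p)
      then show ?case
        using path[of "fst p" "snd p"] by (simp add: Der_pscale[OF d] Der_pscale[OF d'])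
    qed (simp_all add: Der_zero[OF d] Der_zero[OF d'] Der_add[OF d] Der_add[OF d'])
  qed (simp add: Der_outside[OF d] Der_outside[OF d'])
qed

text \<open>By associativity the two terms \<open>xay\<close> cancel in (ax - xa)y + x(ay - ya),
  leaving a(xy) - (xy)a.\<close>

lemma inner_der_in_Der:
  assumes "a \<in> path_algebra G"
  shows "inner_der G a \<in> Der G"
  using assms
  by (intro DerI)
    (simp_all add: inner_der_def path_algebra_diff path_algebra_pmult path_algebra_add
      path_algebra_pscale pmult_add_left pmult_add_right pmult_pscale_left pmult_pscale_right
      pscale_diff_right pmult_diff_left pmult_diff_right pmult_assoc)

lemma der_minus_in_Der:
  assumes "d \<in> Der G" "d' \<in> Der G"
  shows "der_minus G d d' \<in> Der G"
  using assms
  by (intro DerI)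
    (simp_all add: der_minus_def path_algebra_diff path_algebra_pmult path_algebra_add
      path_algebra_pscale pmult_diff_left pmult_diff_right pscale_diff_right
      Der_closed Der_add Der_pscale Der_pmult)

text \<open>Expanding both composites on a product xy gives the same mixed terms d(x)d'(y) and
  d'(x)d(y), which cancel in the commutator.\<close>

lemma der_bracket_in_Der:
  assumes "d \<in> Der G" "d' \<in> Der G"
  shows "der_bracket G d d' \<in> Der G"
  using assms
  by (intro DerI)
    (simp_all add: der_bracket_def path_algebra_diff path_algebra_pmult path_algebra_add
      path_algebra_pscale pmult_diff_left pmult_diff_right pscale_diff_right
      Der_closed Der_add Der_pscale Der_pmult)

text \<open>Shaped to match the sum that defines \<open>arrow_der_ext\<close>.\<close>

lemma lin_comb_in_Der:
  assumes "\<And>i. i \<in> I \<Longrightarrow> d i \<in> Der G"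
  shows "(\<lambda>b\<in>path_algebra G. \<Sum>i\<in>I. pscale (c i) (d i b)) \<in> Der G"
  using assms
  by (intro DerI)
    (simp_all add: path_algebra_sum path_algebra_pmult path_algebra_add
      path_algebra_pscale pmult_sum_left pmult_sum_right pscale_sum_right pscale_add_right
      pmult_pscale_left pmult_pscale_right
      Der_closed[OF assms] Der_add[OF assms] Der_pscale[OF assms] Der_pmult[OF assms]
      sum.distrib mult.commute)

text \<open>The Leibniz rule expands d(ab - ba); the terms a d(b) - d(b) a cancel and -(d(a) b - b
  d(a)) remains. Taking an arrow derivation for \<open>d\<close> gives the second relation.\<close>

lemma der_bracket_inner_der:
  assumes a: "a \<in> path_algebra G" and d: "d \<in> Der G"
  shows "der_bracket G (inner_der G a) d = der_uminus G (inner_der G (d a))"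
  using a
  by (auto simp: der_bracket_def der_uminus_def inner_der_def restrict_def fun_eq_iff
      Der_closed[OF d] Der_diff[OF d] Der_pmult[OF d] path_algebra_pmult)

text \<open>With \<open>d\<close> the inner derivation of \<open>b\<close>, d(a) = ba - ab is minus
  the commutator of \<open>a\<close> and \<open>b\<close>, so the two signs cancel.\<close>

lemma der_bracket_inner_der_inner_der:
  assumes "a \<in> path_algebra G" "b \<in> path_algebra G"
  shows "der_bracket G (inner_der G a) (inner_der G b) = inner_der G (pcomm G a b)"
  unfolding der_bracket_inner_der[OF assms(1) inner_der_in_Der[OF assms(2)]]
  using assms
  by (auto simp: der_uminus_def pcomm_def inner_der_def restrict_def fun_eq_iff
      pmult_diff_left pmult_diff_right)

section \<open>Arrow derivations\<close>

lemma arrow_der_eq: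
  "arrow_der G r s = (\<lambda>x\<in>path_algebra G. lin_ext (\<lambda>p. arrow_der_path G r s (snd p)) x)"
  by (simp add: arrow_der_def lin_ext_def)

lemma arrow_der_pbasis: "p \<in> paths G \<Longrightarrow> arrow_der G r s (pbasis p) = arrow_der_path G r s (snd p)"
  by (simp add: arrow_der_eq)

context
  fixes r :: 'b and s :: "('a, 'b) qpath"
  assumes r: "r \<in> arcs G" and s: "s \<in> paths G" and s_r: "parallel G s (arrow_path G r)"
begin

lemma parallel_simps: "ptail s = tail G r" "phead G s = head G r"
  using s_r by (simp_all add: parallel_def)

text \<open>Each term replaces one occurrence of \<open>r\<close> by \<open>s\<close>, which has the
  same endpoints, so the result is again a path with the endpoints of the original.\<close>

lemma keys_arrow_der_path:
  "(v, es) \<in> paths G \<Longrightarrow> Poly_Mapping.keys (arrow_der_path G r s es :: ('a, 'b, 'k::field) pelt)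
     \<subseteq> {q \<in> paths G. parallel G q (v, es)}"
proof (induction es arbitrary: v)
  case (Cons e es)
  let ?Q = "{q \<in> paths G. parallel G q (v, e # es)}"
  let ?x = "arrow_der_path G r s es :: ('a, 'b, 'k) pelt"
  have e: "e \<in> arcs G" "v = tail G e" "(head G e, es) \<in> paths G"
    using Cons.prems by auto
  have e_path: "arrow_path G e \<in> paths G"
    using Cons.prems by (auto simp: arrow_path_def)
  have IH: "Poly_Mapping.keys ?x \<subseteq> {q \<in> paths G. parallel G q (head G e, es)}"
    using Cons.IH e by blast
  have *: "Poly_Mapping.keys (pmult G (pbasis (arrow_path G e)) ?x) \<subseteq> ?Q"
    using keys_pmult_subset[of G "pbasis (arrow_path G e)" ?x] IH e_path e
    by (fastforce simp: parallel_def phead_Cons intro: pconcat_in_paths)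
  show ?case
  proof (cases "e = r")
    case True
    let ?y = "pmult G (pbasis s) (pbasis (head G e, es)) :: ('a, 'b, 'k) pelt"
    have "Poly_Mapping.keys ?y \<subseteq> ?Q"
      using keys_pmult_subset[of G "pbasis s" "pbasis (head G e, es)"] s e parallel_simps True
      by (fastforce simp: parallel_def phead_Cons intro: pconcat_in_paths)
    with * True show ?thesis
      using Poly_Mapping.keys_add[of ?y "pmult G (pbasis (arrow_path G e)) ?x"] by auto
  qed (use * in auto)
qed simp

text \<open>The Leibniz rule for composable paths: a replaced arrow lies either in \<open>es\<close>
  or in \<open>fs\<close>.\<close>

lemma arrow_der_path_append:
  "(v, es) \<in> paths G \<Longrightarrow> (w, fs) \<in> paths G \<Longrightarrow> phead G (v, es) = w \<Longrightarrow>
    arrow_der_path G r s (es @ fs)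
      = (pmult G (arrow_der_path G r s es) (pbasis (w, fs))
         + pmult G (pbasis (v, es)) (arrow_der_path G r s fs) :: ('a, 'b, 'k::field) pelt)"
proof (induction es arbitrary: v)
  case Nil
  then show ?case
    \<comment> \<open>Here \<open>v = w\<close>, and the vertex acts as a left identity because
      every path in the derivative of \<open>fs\<close> still starts at \<open>w\<close>.\<close>
    using keys_arrow_der_path[of w fs] by (subst pmult_vertex_left) (auto simp: parallel_def)
next
  case (Cons e es)
  have "pbasis (v, e # es)
      = (pmult G (pbasis (arrow_path G e)) (pbasis (head G e, es)) :: ('a, 'b, 'k) pelt)"
    using Cons.prems by (simp add: pbasis_Cons)
  moreover have "pbasis (head G e, es @ fs)
      = (pmult G (pbasis (head G e, es)) (pbasis (w, fs)) :: ('a, 'b, 'k) pelt)"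
    using Cons.prems by (simp add: pmult_pbasis path_mult_def phead_Cons) (simp add: pconcat_def)
  ultimately show ?case
    using Cons.IH[of "head G e"] Cons.prems
    by (cases "e = r") (simp_all add: phead_Cons pmult_add_left pmult_add_right pmult_assoc)
qed

lemma arrow_der_closed:
  fixes x :: "('a, 'b, 'k::field) pelt"
  shows "x \<in> path_algebra G \<Longrightarrow> arrow_der G r s x \<in> path_algebra G"
proof (induction x rule: path_algebra_induct)
  case (basis c p)
  then have "(arrow_der_path G r s (snd p) :: ('a, 'b, 'k) pelt) \<in> path_algebra G"
    using keys_arrow_der_path[of "fst p" "snd p"] by (auto simp: path_algebra_def)
  with basis show ?case
    by (simp add: arrow_der_eq path_algebra_pscale lin_ext_pscale)
next
  case (add x y)
  then show ?case
    by (simp add: arrow_der_eq path_algebra_add lin_ext_add)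
qed (simp add: arrow_der_eq lin_ext_def)

lemma arrow_der_pmult_pbasis:
  assumes p: "p \<in> paths G" and q: "q \<in> paths G"
  shows "arrow_der G r s (pmult G (pbasis p) (pbasis q))
    = (pmult G (arrow_der G r s (pbasis p)) (pbasis q)
       + pmult G (pbasis p) (arrow_der G r s (pbasis q)) :: ('a, 'b, 'k::field) pelt)"
proof (cases "phead G p = ptail q")
  case True
  then show ?thesis
    using arrow_der_path_append[of "fst p" "snd p" "fst q" "snd q"] p q pconcat_in_paths[OF p q]
    by (simp add: pmult_pbasis path_mult_def arrow_der_pbasis) (simp add: pconcat_def ptail_def)
next
  case False
  \<comment> \<open>Paths in the derivative of \<open>p\<close> end where \<open>p\<close> ends, so
    they still fail to meet \<open>q\<close>; symmetrically for the other summand.\<close>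
  have "pmult G (arrow_der_path G r s (snd p)) (pbasis q) = (0 :: ('a, 'b, 'k) pelt)"
    using keys_arrow_der_path[of "fst p" "snd p"] p False
    by (intro pmult_eq_zeroI) (auto simp: parallel_def)
  moreover have "pmult G (pbasis p) (arrow_der_path G r s (snd q)) = (0 :: ('a, 'b, 'k) pelt)"
    using keys_arrow_der_path[of "fst q" "snd q"] q False
    by (intro pmult_eq_zeroI) (auto simp: parallel_def)
  ultimately show ?thesis
    using p q False by (simp add: arrow_der_pbasis pmult_pbasis path_mult_def)
       (simp add: arrow_der_eq lin_ext_def)
qed

lemma arrow_der_in_Der: "(arrow_der G r s :: ('a, 'b, 'k::field) pelt \<Rightarrow> _) \<in> Der G"
proof (rule DerI)
  let ?d = "arrow_der G r s :: ('a, 'b, 'k) pelt \<Rightarrow> _"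
  show d_add: "?d (x + y) = ?d x + ?d y"
    if "x \<in> path_algebra G" "y \<in> path_algebra G" for x y
    using that by (simp add: arrow_der_eq path_algebra_add lin_ext_add)
  show scale: "?d (pscale c x) = pscale c (?d x)" if "x \<in> path_algebra G" for c x
    using that by (simp add: arrow_der_eq path_algebra_pscale lin_ext_pscale)
  \<comment> \<open>\<open>Der_zero\<close> presupposes membership in \<open>Der G\<close>, so this
    value is computed directly for the zero cases of both inductions.\<close>
  have zero: "?d 0 = 0"
    by (simp add: arrow_der_eq lin_ext_def)
  show "?d (pmult G x y) = pmult G (?d x) y + pmult G x (?d y)"
    if "x \<in> path_algebra G" and y: "y \<in> path_algebra G" for x y
    using that(1)
  \<comment> \<open>Induction on \<open>x\<close>, then on \<open>y\<close> inside the basis case,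
    reduces the Leibniz rule to pairs of paths.\<close>
  proof (induction x rule: path_algebra_induct)
    case (basis c p)
    from y show ?case
    proof (induction y rule: path_algebra_induct)
      case (basis c' q)
      with \<open>p \<in> paths G\<close> show ?case
        by (simp add: scale pmult_pscale_left pmult_pscale_right path_algebra_pmult
            arrow_der_pmult_pbasis pscale_add_right mult.commute path_algebra_pscale)
    next
      case (add y z)
      with basis show ?case
        by (simp add: d_add pmult_add_right path_algebra_pmult path_algebra_pscale)
    qed (simp add: zero)
  next
    case (add x z)
    with y show ?case
      by (simp add: d_add pmult_add_left path_algebra_pmult)
  qed (simp add: zero)
qed (simp_all add: arrow_der_closed, simp add: arrow_der_def)

lemma arrow_der_vertex: "v \<in> verts G \<Longrightarrow> arrow_der G r s (pbasis (v, [])) = 0"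
  by (simp add: arrow_der_pbasis)

lemma arrow_der_arrow:
  assumes "e \<in> arcs G"
  shows "arrow_der G r s (pbasis (arrow_path G e)) = (if e = r then pbasis s else 0)"
proof -
  have "arrow_path G e \<in> paths G"
    using assms by (simp add: arrow_path_def)
  then show ?thesis
    \<comment> \<open>When \<open>e = r\<close> the recursion gives \<open>s\<close> times the
      vertex \<open>head G r\<close>, which is \<open>s\<close> because \<open>s\<close> ends
      there.\<close>
    using parallel_simps by (simp add: arrow_der_pbasis)
      (simp add: arrow_path_def pmult_pbasis path_mult_def pconcat_def)
qed

end

section \<open>The derivations \<open>arrow_der_ext\<close> and the third relation\<close>

lemma arrow_der_ext_in_Der:
  assumes "p \<in> arcs G" "x \<in> path_algebra G"
  shows "arrow_der_ext G p x \<in> Der G"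
  unfolding arrow_der_ext_def using assms
  by (intro lin_comb_in_Der arrow_der_in_Der) (auto simp: path_algebra_def)

lemma arrow_der_ext_vertex:
  assumes "p \<in> arcs G" "x \<in> path_algebra G" "v \<in> verts G"
  shows "arrow_der_ext G p x (pbasis (v, [])) = 0"
  using assms by (auto simp: arrow_der_ext_def arrow_der_pbasis intro!: sum.neutral)

lemma arrow_der_ext_arrow:
  assumes p: "p \<in> arcs G" and e: "e \<in> arcs G"
    and x: "Poly_Mapping.keys x \<subseteq> {q \<in> paths G. parallel G q (arrow_path G p)}"
  shows "arrow_der_ext G p x (pbasis (arrow_path G e)) = (if e = p then x else 0)"
proof -
  have "arrow_path G e \<in> paths G"
    using e by (simp add: arrow_path_def)
  \<comment> \<open>The parallelism filter removes nothing here, so at \<open>e = p\<close> the sum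
    is the full basis expansion of \<open>x\<close>.\<close>
  moreover have "{q \<in> Poly_Mapping.keys x. parallel G q (arrow_path G p)} = Poly_Mapping.keys x"
    using x by auto
  ultimately have "arrow_der_ext G p x (pbasis (arrow_path G e))
    = (\<Sum>q\<in>Poly_Mapping.keys x. pscale (Poly_Mapping.lookup x q) (if e = p then pbasis q else 0))"
    unfolding arrow_der_ext_def using x p e
    by (auto simp: arrow_der_arrow intro!: sum.cong)
  then show ?thesis
    by (simp add: pelt_expansion)
qed

lemma der_bracket_arrow_der:
  fixes r p :: 'b and s q :: "('a, 'b) qpath"
  defines "dr \<equiv> arrow_der G r s :: ('a, 'b, 'k::field) pelt \<Rightarrow> _" and "dp \<equiv> arrow_der G p q"
  assumes r: "r \<in> arcs G" "s \<in> paths G" "parallel G s (arrow_path G r)"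
    and p: "p \<in> arcs G" "q \<in> paths G" "parallel G q (arrow_path G p)"
  shows "der_bracket G dr dp
    = der_minus G (arrow_der_ext G p (dr (pbasis q))) (arrow_der_ext G r (dp (pbasis s)))"
proof -
  have dr: "dr \<in> Der G" and dp: "dp \<in> Der G"
    unfolding dr_def dp_def using r p by (simp_all add: arrow_der_in_Der)
  have closed: "dr (pbasis q) \<in> path_algebra G" "dp (pbasis s) \<in> path_algebra G"
    using r p by (simp_all add: Der_closed dr dp)
  have "Poly_Mapping.keys (dr (pbasis q)) \<subseteq> {u \<in> paths G. parallel G u q}"
    "Poly_Mapping.keys (dp (pbasis s)) \<subseteq> {u \<in> paths G. parallel G u s}"
    using keys_arrow_der_path[OF r, of "fst q" "snd q", where 'k = 'k]
      keys_arrow_der_path[OF p, of "fst s" "snd s", where 'k = 'k] r p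
    by (simp_all add: dr_def dp_def arrow_der_pbasis)
  \<comment> \<open>Parallelism is passed on from \<open>q\<close> to the arrow \<open>p\<close> and
    from \<open>s\<close> to the arrow \<open>r\<close>, as \<open>arrow_der_ext_arrow\<close>
    requires.\<close>
  then have keys:
    "Poly_Mapping.keys (dr (pbasis q)) \<subseteq> {u \<in> paths G. parallel G u (arrow_path G p)}"
    "Poly_Mapping.keys (dp (pbasis s)) \<subseteq> {u \<in> paths G. parallel G u (arrow_path G r)}"
    using r p by (auto simp: parallel_def)
  show ?thesis
  proof (rule Der_eqI)
    show "der_bracket G dr dp \<in> Der G"
      by (rule der_bracket_in_Der[OF dr dp])
    show "der_minus G (arrow_der_ext G p (dr (pbasis q))) (arrow_der_ext G r (dp (pbasis s))) \<in> Der G"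
      using closed r p by (intro der_minus_in_Der arrow_der_ext_in_Der)
  next
    fix v assume v: "v \<in> verts G"
    then have "dr (pbasis (v, [])) = 0" "dp (pbasis (v, [])) = 0"
      using arrow_der_vertex r p by (simp_all add: dr_def dp_def)
    with v show "der_bracket G dr dp (pbasis (v, []))
      = der_minus G (arrow_der_ext G p (dr (pbasis q))) (arrow_der_ext G r (dp (pbasis s)))
          (pbasis (v, []))"
      using closed r p
      by (simp add: der_bracket_def der_minus_def arrow_der_ext_vertex Der_zero[OF dr] Der_zero[OF dp])
  next
    fix e assume e: "e \<in> arcs G"
    have "arrow_path G e \<in> paths G"
      using e by (simp add: arrow_path_def)
    \<comment> \<open>Hence \<open>dr\<close> after \<open>dp\<close> yields
      \<open>dr (pbasis q)\<close> exactly at \<open>e = p\<close>, and 0 elsewhere;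
      \<open>dp\<close> after \<open>dr\<close> yields \<open>dp (pbasis s)\<close> exactly at
      \<open>e = r\<close>. The case \<open>p = r\<close> is included.\<close>
    moreover have "dr (pbasis (arrow_path G e)) = (if e = r then pbasis s else 0)"
      "dp (pbasis (arrow_path G e)) = (if e = p then pbasis q else 0)"
      using arrow_der_arrow[OF r e] arrow_der_arrow[OF p e] by (simp_all add: dr_def dp_def)
    ultimately show "der_bracket G dr dp (pbasis (arrow_path G e))
      = der_minus G (arrow_der_ext G p (dr (pbasis q))) (arrow_der_ext G r (dp (pbasis s)))
          (pbasis (arrow_path G e))"
      using arrow_der_ext_arrow[OF p(1) e keys(1)] arrow_der_ext_arrow[OF r(1) e keys(2)]
      by (simp add: der_bracket_def der_minus_def Der_zero[OF dr] Der_zero[OF dp])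
  qed
qed

end

theorem theorem3p5:
  fixes G :: "('v, 'e) pre_digraph"
    and D :: "('v, 'e, 'k::field) pelt \<Rightarrow> ('v, 'e, 'k) pelt \<Rightarrow> ('v, 'e, 'k) pelt"
    and D_arr :: "'e \<Rightarrow> ('v, 'e) qpath \<Rightarrow> ('v, 'e, 'k) pelt \<Rightarrow> ('v, 'e, 'k) pelt"
    and D_ext :: "'e \<Rightarrow> ('v, 'e, 'k) pelt \<Rightarrow> ('v, 'e, 'k) pelt \<Rightarrow> ('v, 'e, 'k) pelt"
  assumes "fin_digraph G"
  defines "D \<equiv> inner_der G" and "D_arr \<equiv> arrow_der G" and "D_ext \<equiv> arrow_der_ext G"
  shows
    "(\<forall>a\<in>path_algebra G. D a \<in> Der G) \<and>
     (\<forall>r\<in>arcs G. \<forall>s\<in>paths G. parallel G s (arrow_path G r) \<longrightarrow> D_arr r s \<in> Der G) \<and>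
     (\<forall>p\<in>arcs G. \<forall>x\<in>path_algebra G. D_ext p x \<in> Der G) \<and>
     (\<forall>p\<in>paths G. \<forall>r\<in>paths G.
        der_bracket G (D (pbasis p)) (D (pbasis r)) = D (pcomm G (pbasis p) (pbasis r))) \<and>
     (\<forall>r\<in>arcs G. \<forall>p\<in>paths G. \<forall>s\<in>paths G. parallel G s (arrow_path G r) \<longrightarrow>
        der_bracket G (D (pbasis p)) (D_arr r s)
          = der_uminus G (D (D_arr r s (pbasis p)))) \<and>
     (\<forall>r\<in>arcs G. \<forall>p\<in>arcs G. \<forall>s\<in>paths G. \<forall>q\<in>paths G.
        parallel G s (arrow_path G r) \<longrightarrow> parallel G q (arrow_path G p) \<longrightarrow>
        der_bracket G (D_arr r s) (D_arr p q)
          = der_minus G (D_ext p (D_arr r s (pbasis q))) (D_ext r (D_arr p q (pbasis s))))"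
proof -
  interpret fin_digraph G
    by fact
  show ?thesis
    unfolding D_def D_arr_def D_ext_def
    \<comment> \<open>The rules leave only membership and parallelism conditions, with basis paths
      lying in the path algebra.\<close>
    by (intro conjI ballI impI inner_der_in_Der arrow_der_in_Der arrow_der_ext_in_Der
        der_bracket_inner_der_inner_der der_bracket_inner_der der_bracket_arrow_der) simp_all
qed

end
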